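(* The category whose objects are skew braces (regarded as groups with braiding operators $(G,m,e,r)$) and whose morphisms are Drinfeld twists between them, where a Drinfeld twist $(F,\Phi,\Psi)$ on $(G,m,e,r)$ is viewed as a morphism from $(G,m,e,r)$ to $(G,mF^{-1},e,FrF^{-1})$, forms a subgroupoid of the groupoid of set-theoretical YBE solutions and Drinfeld twists; that is, with the composition, identities and inverses of that groupoid, Drinfeld twists between skew braces form a groupoid.
   Context: For a map $f:X^2\to X^2$, write $f_{12}=f\times\mathrm{id}_X$ and $f_{23}=\mathrm{id}_X\times f$ as maps $X^3\to X^3$. For a group $(G,m,e)$, $m_{12}(x,y,z)=(xy,z)$ and $m_{23}(x,y,z)=(x,yz)$. Juxtaposition of maps denotes composition. A set-theoretical YBE solution $(X,r)$ is a set $X$ with an invertible map $r:X^2\to X^2$ satisfying $r_{23}r_{12}r_{23}=r_{12}r_{23}r_{12}$. A Drinfeld twist on $(X,r)$ is a triple of invertible maps $F:X^2\to X^2$, $\Phi,\Psi:X^3\to X^3$ satisfying (T1) $F_{12}\Psi=F_{23}\Phi$, (T2) $\Phi r_{23}=r_{23}\Phi$, (T3) $\Psi r_{12}=r_{12}\Psi$. The groupoid of YBE solutions: objects are set-theoretical YBE solutions; a Drinfeld twist $(F,\Phi,\Psi)$ on $(X,r)$ is a morphism $(X,r)\to(X,FrF^{-1})$; the composite of $(F,\Phi,\Psi)$ on $(X,r)$ followed by $(\mathbf F,\phi,\psi)$ on $(X,FrF^{-1})$ is $(\mathbf F F,\ F_{23}^{-1}\phi F_{23}\Phi,\ F_{12}^{-1}\psi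 F_{12}\Psi)$; identities are $(\mathrm{id}_{X^2},\mathrm{id}_{X^3},\mathrm{id}_{X^3})$; the inverse of $(F,\Phi,\Psi)$ is $(F^{-1},F_{23}\Phi^{-1}F_{23}^{-1},F_{12}\Psi^{-1}F_{12}^{-1})$. A braiding operator on a group $(G,m,e)$ is a map $r:G^2\to G^2$ satisfying $r(e,g)=(g,e)$, $r(g,e)=(e,g)$ for all $g$; $r m_{12}=m_{23}r_{12}r_{23}$; $r m_{23}=m_{12}r_{23}r_{12}$; and $mr=m$ (then $(G,r)$ is a YBE solution). Groups with braiding operators are equivalent to skew braces, and the terms are used interchangeably. A Drinfeld twist on a group $(G,m,e)$ with braiding operator $r$ is a Drinfeld twist $(F,\Phi,\Psi)$ on the YBE solution $(G,r)$ satisfying in addition, for all $x,y,z\in G$, (G1) $\Psi(x,y,e)=(x,y,e)$ and $\Phi(e,x,y)=(e,x,y)$; (G2) $F(e,x)=(e,x)$ and $F(x,e)=(x,e)$; (G3) $m_{23}\Phi(x,y,z)=F(x,yz)$; (G4) $m_{12}\Psi(x,y,z)=F(xy,z)$. For such a twist $(G,mF^{-1},e)$ is a group with braiding operator $FrF^{-1}$. *)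

theory Defs
  imports "HOL-Algebra.Group" "HOL-Combinatorics.Permutations"
begin

text \<open>
  Sets are carriers in an arbitrary type. For morphisms and objects to be equal exactly when the
  underlying maps agree on the carriers, every map is given a fixed value outside its domain:
  self-maps of \<open>X\<^sup>2\<close> and \<open>X\<^sup>3\<close> are the identity there (so the invertible ones are the \<^const>\<open>permutes\<close>
  of the library), and a group multiplication is \<^const>\<open>extensional\<close>.
  These conventions are preserved by all operations below, so that plain composition and the plain
  inverse function can be used. The latter is written \<open>inv_into UNIV\<close> because HOL-Algebra
  reuses the notation for the inverse in a group.
\<close>

type_synonym 'a map2 = "'a \<times> 'a \<Rightarrow> 'a \<times> 'a"
type_synonym 'a map3 = "'a \<times> 'a \<times> 'a \<Rightarrow> 'a \<times> 'a \<times> 'a"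
type_synonym 'a twist = "'a map2 \<times> 'a map3 \<times> 'a map3"

fun leg12 :: "'a map2 \<Rightarrow> 'a map3" where
  "leg12 f (x, y, z) = (let (a, b) = f (x, y) in (a, b, z))"

fun leg23 :: "'a map2 \<Rightarrow> 'a map3" where
  "leg23 f (x, y, z) = (x, f (y, z))"

fun mult12 :: "('a \<times> 'a \<Rightarrow> 'a) \<Rightarrow> 'a \<times> 'a \<times> 'a \<Rightarrow> 'a \<times> 'a" where
  "mult12 m (x, y, z) = (m (x, y), z)"

fun mult23 :: "('a \<times> 'a \<Rightarrow> 'a) \<Rightarrow> 'a \<times> 'a \<times> 'a \<Rightarrow> 'a \<times> 'a" where
  "mult23 m (x, y, z) = (x, m (y, z))"


section \<open>Groupoids\<close>

record ('o, 'm) groupoid_data =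
  Obj :: "'o set"
  Arr :: "'m set"
  Dom :: "'m \<Rightarrow> 'o"
  Cod :: "'m \<Rightarrow> 'o"
  Comp :: "'m \<Rightarrow> 'm \<Rightarrow> 'm"  \<comment> \<open>\<open>Comp C g f\<close> is \<open>f\<close> followed by \<open>g\<close>\<close>
  Ident :: "'o \<Rightarrow> 'm"
  Inver :: "'m \<Rightarrow> 'm"

locale groupoid =
  fixes C :: "('o, 'm) groupoid_data"
  assumes Dom_Obj: "f \<in> Arr C \<Longrightarrow> Dom C f \<in> Obj C"
    and Cod_Obj: "f \<in> Arr C \<Longrightarrow> Cod C f \<in> Obj C"
    and Comp_Arr: "\<lbrakk>f \<in> Arr C; g \<in> Arr C; Dom C g = Cod C f\<rbrakk> \<Longrightarrow> Comp C g f \<in> Arr C"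
    and Dom_Comp: "\<lbrakk>f \<in> Arr C; g \<in> Arr C; Dom C g = Cod C f\<rbrakk> \<Longrightarrow> Dom C (Comp C g f) = Dom C f"
    and Cod_Comp: "\<lbrakk>f \<in> Arr C; g \<in> Arr C; Dom C g = Cod C f\<rbrakk> \<Longrightarrow> Cod C (Comp C g f) = Cod C g"
    and Comp_assoc:
      "\<lbrakk>f \<in> Arr C; g \<in> Arr C; h \<in> Arr C; Dom C g = Cod C f; Dom C h = Cod C g\<rbrakk>
        \<Longrightarrow> Comp C h (Comp C g f) = Comp C (Comp C h g) f"
    and Ident_Arr: "A \<in> Obj C \<Longrightarrow> Ident C A \<in> Arr C"
    and Dom_Ident: "A \<in> Obj C \<Longrightarrow> Dom C (Ident C A) = A"
    and Cod_Ident: "A \<in> Obj C \<Longrightarrow> Cod C (Ident C A) = A"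
    and Comp_Ident_right: "f \<in> Arr C \<Longrightarrow> Comp C f (Ident C (Dom C f)) = f"
    and Comp_Ident_left: "f \<in> Arr C \<Longrightarrow> Comp C (Ident C (Cod C f)) f = f"
    and Inver_Arr: "f \<in> Arr C \<Longrightarrow> Inver C f \<in> Arr C"
    and Dom_Inver: "f \<in> Arr C \<Longrightarrow> Dom C (Inver C f) = Cod C f"
    and Cod_Inver: "f \<in> Arr C \<Longrightarrow> Cod C (Inver C f) = Dom C f"
    and Comp_Inver_left: "f \<in> Arr C \<Longrightarrow> Comp C (Inver C f) f = Ident C (Dom C f)"
    and Comp_Inver_right: "f \<in> Arr C \<Longrightarrow> Comp C f (Inver C f) = Ident C (Cod C f)"

text \<open>
  A subgroupoid whose objects may carry additional structure: the object map \<open>U\<close> forgets that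
  structure and need not be injective, the arrow map \<open>V\<close> is injective on each hom-set, and all
  operations of \<open>C\<close> are those of \<open>D\<close>. This is a faithful functor from \<open>C\<close> to \<open>D\<close>.
\<close>

locale subgroupoid_along = C: groupoid C + D: groupoid D
  for C :: "('o, 'm) groupoid_data" and D :: "('p, 'n) groupoid_data"
  and U :: "'o \<Rightarrow> 'p" and V :: "'m \<Rightarrow> 'n" +
  assumes U_Obj: "A \<in> Obj C \<Longrightarrow> U A \<in> Obj D"
    and V_Arr: "f \<in> Arr C \<Longrightarrow> V f \<in> Arr D"
    and V_Dom: "f \<in> Arr C \<Longrightarrow> Dom D (V f) = U (Dom C f)"
    and V_Cod: "f \<in> Arr C \<Longrightarrow> Cod D (V f) = U (Cod C f)"
    and V_Comp: "\<lbrakk>f \<in> Arr C; g \<in> Arr C; Dom C g = Cod C f\<rbrakk>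
      \<Longrightarrow> V (Comp C g f) = Comp D (V g) (V f)"
    and V_Ident: "A \<in> Obj C \<Longrightarrow> V (Ident C A) = Ident D (U A)"
    and V_Inver: "f \<in> Arr C \<Longrightarrow> V (Inver C f) = Inver D (V f)"
    and V_faithful: "\<lbrakk>f \<in> Arr C; g \<in> Arr C; Dom C f = Dom C g; Cod C f = Cod C g; V f = V g\<rbrakk>
      \<Longrightarrow> f = g"


section \<open>Drinfeld twists on YBE solutions\<close>

type_synonym 'a ybe_obj = "'a set \<times> 'a map2"

fun YBE_solution :: "'a ybe_obj \<Rightarrow> bool" where
  "YBE_solution (X, r) \<longleftrightarrow>
    r permutes (X \<times> X) \<and>
    (\<forall>t \<in> X \<times> X \<times> X. (leg23 r \<circ> leg12 r \<circ> leg23 r) t = (leg12 r \<circ> leg23 r \<circ> leg12 r) t)"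

fun drinfeld_twist :: "'a ybe_obj \<Rightarrow> 'a twist \<Rightarrow> bool" where
  "drinfeld_twist (X, r) (F, \<Phi>, \<Psi>) \<longleftrightarrow>
    F permutes (X \<times> X) \<and> \<Phi> permutes (X \<times> X \<times> X) \<and> \<Psi> permutes (X \<times> X \<times> X) \<and>
    (\<forall>t \<in> X \<times> X \<times> X.
      (leg12 F \<circ> \<Psi>) t = (leg23 F \<circ> \<Phi>) t \<and>
      (\<Phi> \<circ> leg23 r) t = (leg23 r \<circ> \<Phi>) t \<and>
      (\<Psi> \<circ> leg12 r) t = (leg12 r \<circ> \<Psi>) t)"

fun ybe_target :: "'a ybe_obj \<Rightarrow> 'a twist \<Rightarrow> 'a ybe_obj" where
  "ybe_target (X, r) (F, \<Phi>, \<Psi>) = (X, F \<circ> r \<circ> inv_into UNIV F)"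

text \<open>\<open>twist_comp u t\<close> is \<open>t\<close> followed by \<open>u\<close>.\<close>

fun twist_comp :: "'a twist \<Rightarrow> 'a twist \<Rightarrow> 'a twist" where
  "twist_comp (F', \<phi>, \<psi>) (F, \<Phi>, \<Psi>) =
    (F' \<circ> F,
     inv_into UNIV (leg23 F) \<circ> \<phi> \<circ> leg23 F \<circ> \<Phi>,
     inv_into UNIV (leg12 F) \<circ> \<psi> \<circ> leg12 F \<circ> \<Psi>)"

definition twist_id :: "'a twist" where
  "twist_id = (id, id, id)"

fun twist_inv :: "'a twist \<Rightarrow> 'a twist" where
  "twist_inv (F, \<Phi>, \<Psi>) =
    (inv_into UNIV F,
     leg23 F \<circ> inv_into UNIV \<Phi> \<circ> inv_into UNIV (leg23 F),
     leg12 F \<circ> inv_into UNIV \<Psi> \<circ> inv_into UNIV (leg12 F))"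

text \<open>An arrow is a twist together with the object it is a twist on.\<close>

definition YBE_groupoid :: "('a ybe_obj, 'a ybe_obj \<times> 'a twist) groupoid_data" where
  "YBE_groupoid =
    \<lparr>Obj = {S. YBE_solution S},
     Arr = {(S, t). YBE_solution S \<and> drinfeld_twist S t},
     Dom = fst,
     Cod = (\<lambda>(S, t). ybe_target S t),
     Comp = (\<lambda>(S', u) (S, t). (S, twist_comp u t)),
     Ident = (\<lambda>S. (S, twist_id)),
     Inver = (\<lambda>(S, t). (ybe_target S t, twist_inv t))\<rparr>"


section \<open>Drinfeld twists on skew braces\<close>

type_synonym 'a brace_obj = "'a set \<times> ('a \<times> 'a \<Rightarrow> 'a) \<times> 'a \<times> 'a map2"

fun braiding_operator :: "'a brace_obj \<Rightarrow> bool" where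
  "braiding_operator (G, m, e, r) \<longleftrightarrow>
    r \<in> G \<times> G \<rightarrow> G \<times> G \<and> (\<forall>p. p \<notin> G \<times> G \<longrightarrow> r p = p) \<and>
    (\<forall>g \<in> G. r (e, g) = (g, e) \<and> r (g, e) = (e, g)) \<and>
    (\<forall>t \<in> G \<times> G \<times> G.
      (r \<circ> mult12 m) t = (mult23 m \<circ> leg12 r \<circ> leg23 r) t \<and>
      (r \<circ> mult23 m) t = (mult12 m \<circ> leg23 r \<circ> leg12 r) t) \<and>
    (\<forall>p \<in> G \<times> G. (m \<circ> r) p = m p)"

fun skew_brace :: "'a brace_obj \<Rightarrow> bool" where
  "skew_brace (G, m, e, r) \<longleftrightarrow>
    group \<lparr>carrier = G, monoid.mult = curry m, one = e\<rparr> \<and> m \<in> extensional (G \<times> G) \<and>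
    braiding_operator (G, m, e, r)"

fun brace_twist :: "'a brace_obj \<Rightarrow> 'a twist \<Rightarrow> bool" where
  "brace_twist (G, m, e, r) (F, \<Phi>, \<Psi>) \<longleftrightarrow>
    drinfeld_twist (G, r) (F, \<Phi>, \<Psi>) \<and>
    (\<forall>x \<in> G. \<forall>y \<in> G. \<Psi> (x, y, e) = (x, y, e) \<and> \<Phi> (e, x, y) = (e, x, y)) \<and>
    (\<forall>x \<in> G. F (e, x) = (e, x) \<and> F (x, e) = (x, e)) \<and>
    (\<forall>x \<in> G. \<forall>y \<in> G. \<forall>z \<in> G.
      mult23 m (\<Phi> (x, y, z)) = F (x, m (y, z)) \<and>
      mult12 m (\<Psi> (x, y, z)) = F (m (x, y), z))"

fun brace_target :: "'a brace_obj \<Rightarrow> 'a twist \<Rightarrow> 'a brace_obj" where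
  "brace_target (G, m, e, r) (F, \<Phi>, \<Psi>) = (G, m \<circ> inv_into UNIV F, e, F \<circ> r \<circ> inv_into UNIV F)"

definition skew_brace_groupoid :: "('a brace_obj, 'a brace_obj \<times> 'a twist) groupoid_data" where
  "skew_brace_groupoid =
    \<lparr>Obj = {B. skew_brace B},
     Arr = {(B, t). skew_brace B \<and> brace_twist B t},
     Dom = fst,
     Cod = (\<lambda>(B, t). brace_target B t),
     Comp = (\<lambda>(B', u) (B, t). (B, twist_comp u t)),
     Ident = (\<lambda>B. (B, twist_id)),
     Inver = (\<lambda>(B, t). (brace_target B t, twist_inv t))\<rparr>"

fun underlying_ybe :: "'a brace_obj \<Rightarrow> 'a ybe_obj" where
  "underlying_ybe (G, m, e, r) = (G, r)"

definition underlying_arr :: "'a brace_obj \<times> 'a twist \<Rightarrow> 'a ybe_obj \<times> 'a twist" where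
  "underlying_arr = map_prod underlying_ybe id"

end

theory Submission
  imports Defs
begin

text \<open>
  The proof rests on one map. For a twist \<open>(F, \<Phi>, \<Psi>)\<close> on \<open>(X, r)\<close> put
  \<open>K = F\<^sub>1\<^sub>2 \<Psi> = F\<^sub>2\<^sub>3 \<Phi>\<close>, a permutation of \<open>X\<^sup>3\<close>, and \<open>r' = F r F\<inverse>\<close>. The first form
  of \<open>K\<close> and (T3) give \<open>r'\<^sub>1\<^sub>2 K = K r\<^sub>1\<^sub>2\<close>, the second form and (T2) give \<open>r'\<^sub>2\<^sub>3 K = K r\<^sub>2\<^sub>3\<close>.
  So conjugation by \<open>K\<close> carries the Yang-Baxter equation from \<open>r\<close> to \<open>r'\<close> (\<open>YBE_solution_target\<close>).

  On a group, with \<open>m' = m F\<inverse>\<close>, the conditions (G3) and (G4) likewise say \<open>m'\<^sub>2\<^sub>3 K = F m\<^sub>2\<^sub>3\<close> and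
  \<open>m'\<^sub>1\<^sub>2 K = F m\<^sub>1\<^sub>2\<close>. Thus \<open>F\<close> on pairs and \<open>K\<close> on triples transport associativity and the braiding
  axioms to \<open>(m', r')\<close>. Existence of inverses is not an identity and needs an argument of its own:
  evaluate both forms of \<open>K\<close> at \<open>(a, a\<inverse>, a)\<close> (\<open>target_inverse\<close>). Together these give
  \<open>skew_brace_target\<close>.

  A braiding operator is only assumed to be a self-map of \<open>G\<^sup>2\<close>; that it is invertible and solves the
  Yang-Baxter equation follows from reading its two components as a left and a right action of
  \<open>G\<close> on itself (\<open>r_permutes\<close>, \<open>yang_baxter\<close>).

  What is left is that the twist axioms are stable under composition and inversion, where the
  conjugation by \<open>F\<^sub>1\<^sub>2\<close> and \<open>F\<^sub>2\<^sub>3\<close> in the formulas turns conditions about \<open>(m', r')\<close> into conditions about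
  \<open>(m, r)\<close>. The associativity, unit and inverse laws for arrows are formal cancellations.
\<close>

section \<open>Legs of a map on pairs\<close>

abbreviation inverse_map :: "('a \<Rightarrow> 'b) \<Rightarrow> 'b \<Rightarrow> 'a" where
  "inverse_map f \<equiv> inv_into UNIV f"

(* Points of X^3 are kept as single variables, so that compositions of legs rewrite as maps. *)
declare split_paired_Ball_Sigma [simp del] leg23.simps [simp del]

lemma leg23_apply [simp]: "leg23 f (x, p) = (x, f p)"
  by (cases p) (simp add: leg23.simps)

lemma apply_pairwise:
  "leg12 f (x, p) = (fst (f (x, fst p)), snd (f (x, fst p)), snd p)"
  "mult12 m (x, p) = (m (x, fst p), snd p)"
  "mult23 m (x, p) = (x, m p)"
  by (cases p; simp add: case_prod_beta)+

lemma leg12_comp: "leg12 (f \<circ> g) = leg12 f \<circ> leg12 g"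
  by (auto simp: fun_eq_iff split: prod.splits)

lemma leg23_comp: "leg23 (f \<circ> g) = leg23 f \<circ> leg23 g"
  by (auto simp: fun_eq_iff)

lemma leg12_id [simp]: "leg12 id = id"
  by (auto simp: fun_eq_iff)

lemma leg23_id [simp]: "leg23 id = id"
  by (auto simp: fun_eq_iff)

lemma leg12_inverse_map:
  assumes "bij f"
  shows "inverse_map (leg12 f) = leg12 (inverse_map f)"
proof (rule inv_unique_comp)
  show "leg12 f \<circ> leg12 (inverse_map f) = id" "leg12 (inverse_map f) \<circ> leg12 f = id"
    using assms by (simp_all flip: leg12_comp add: bij_is_surj bij_is_inj surj_iff[THEN iffD1] inj_iff[THEN iffD1])
qed

lemma leg23_inverse_map:
  assumes "bij f"
  shows "inverse_map (leg23 f) = leg23 (inverse_map f)"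
proof (rule inv_unique_comp)
  show "leg23 f \<circ> leg23 (inverse_map f) = id" "leg23 (inverse_map f) \<circ> leg23 f = id"
    using assms by (simp_all flip: leg23_comp add: bij_is_surj bij_is_inj surj_iff[THEN iffD1] inj_iff[THEN iffD1])
qed

lemma leg12_closed:
  assumes "f permutes X \<times> X"
  shows "leg12 f t \<in> X \<times> X \<times> X \<longleftrightarrow> t \<in> X \<times> X \<times> X"
proof (cases t)
  case (fields x y z)
  have "f (x, y) \<in> X \<times> X \<longleftrightarrow> (x, y) \<in> X \<times> X"
    by (rule permutes_in_image[OF assms])
  then show ?thesis
    by (cases "f (x, y)") (auto simp: fields)
qed

lemma leg23_closed:
  assumes "f permutes X \<times> X"
  shows "leg23 f t \<in> X \<times> X \<times> X \<longleftrightarrow> t \<in> X \<times> X \<times> X"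
proof (cases t)
  case (fields x y z)
  have "f (y, z) \<in> X \<times> X \<longleftrightarrow> (y, z) \<in> X \<times> X"
    by (rule permutes_in_image[OF assms])
  then show ?thesis
    by (auto simp: fields)
qed

text \<open>
  The leg \<open>leg23 F\<close> of a permutation of \<open>X\<^sup>2\<close> also moves triples \<open>(x, y, z)\<close> with \<open>x\<close> outside \<open>X\<close>,
  so it does not permute \<open>X\<^sup>3\<close> in the strict sense. Conjugation by it still preserves the
  permutations of \<open>X\<^sup>3\<close>, because it maps the complement of \<open>X\<^sup>3\<close> to itself.
\<close>

lemma conjugate_permutes:
  assumes g: "g permutes S" and h: "\<And>t. h t \<in> S \<longleftrightarrow> t \<in> S"
    and k: "h \<circ> k = id" "k \<circ> h = id"
  shows "k \<circ> g \<circ> h permutes S"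
proof -
  have "bij k" "bij h"
    using k by (metis o_bij)+
  then have "bij (k \<circ> g \<circ> h)"
    using permutes_bij[OF g] by (intro bij_comp)
  moreover have "(k \<circ> g \<circ> h) t = t" if "t \<notin> S" for t
    using that h permutes_not_in[OF g, of "h t"] k(2) by (auto simp: fun_eq_iff)
  ultimately show ?thesis
    unfolding permutes_def by (metis bij_pointE)
qed

section \<open>Drinfeld twists on YBE solutions\<close>

locale twist_on =
  fixes X :: "'a set" and r F :: "'a map2" and \<Phi> \<Psi> :: "'a map3"
  assumes twist: "drinfeld_twist (X, r) (F, \<Phi>, \<Psi>)"
begin

abbreviation "X3 \<equiv> X \<times> X \<times> X"
abbreviation "iF \<equiv> inverse_map F"
abbreviation "i\<Phi> \<equiv> inverse_map \<Phi>"
abbreviation "i\<Psi> \<equiv> inverse_map \<Psi>"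
abbreviation "r' \<equiv> F \<circ> r \<circ> iF"
abbreviation "K \<equiv> leg12 F \<circ> \<Psi>"

lemma F_permutes: "F permutes X \<times> X"
  and \<Phi>_permutes: "\<Phi> permutes X3"
  and \<Psi>_permutes: "\<Psi> permutes X3"
  using twist by auto

lemma bij_F: "bij F"
  using F_permutes by (rule permutes_bij)

lemma iF_permutes: "iF permutes X \<times> X"
  and i\<Phi>_permutes: "i\<Phi> permutes X3"
  and i\<Psi>_permutes: "i\<Psi> permutes X3"
  using F_permutes \<Phi>_permutes \<Psi>_permutes by (simp_all add: permutes_inv)

lemma cancel [simp]:
  "F (iF p) = p" "iF (F p) = p" "\<Phi> (i\<Phi> t) = t" "i\<Phi> (\<Phi> t) = t" "\<Psi> (i\<Psi> t) = t" "i\<Psi> (\<Psi> t) = t"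
  using F_permutes \<Phi>_permutes \<Psi>_permutes by (simp_all add: permutes_inverses)

lemma comp_cancel [simp]:
  "F \<circ> iF = id" "iF \<circ> F = id" "\<Phi> \<circ> i\<Phi> = id" "i\<Phi> \<circ> \<Phi> = id" "\<Psi> \<circ> i\<Psi> = id" "i\<Psi> \<circ> \<Psi> = id"
  by (simp_all add: fun_eq_iff)

lemma inverse_map_inverse_map [simp]: "inverse_map iF = F" "inverse_map i\<Phi> = \<Phi>" "inverse_map i\<Psi> = \<Psi>"
  using F_permutes \<Phi>_permutes \<Psi>_permutes by (simp_all add: permutes_inv_inv)

lemma inverse_map_leg [simp]:
  "inverse_map (leg12 F) = leg12 iF" "inverse_map (leg23 F) = leg23 iF"
  using bij_F by (simp_all add: leg12_inverse_map leg23_inverse_map)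

lemma leg_comp_cancel [simp]:
  "leg12 F \<circ> leg12 iF = id" "leg12 iF \<circ> leg12 F = id"
  "leg23 F \<circ> leg23 iF = id" "leg23 iF \<circ> leg23 F = id"
  by (simp_all flip: leg12_comp leg23_comp)

lemma leg_cancel [simp]:
  "leg12 F (leg12 iF t) = t" "leg12 iF (leg12 F t) = t"
  "leg23 F (leg23 iF t) = t" "leg23 iF (leg23 F t) = t"
  using leg_comp_cancel by (metis comp_apply id_apply)+

lemma closed [simp]:
  "F p \<in> X \<times> X \<longleftrightarrow> p \<in> X \<times> X" "iF p \<in> X \<times> X \<longleftrightarrow> p \<in> X \<times> X"
  "\<Phi> t \<in> X3 \<longleftrightarrow> t \<in> X3" "\<Psi> t \<in> X3 \<longleftrightarrow> t \<in> X3"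
  "i\<Phi> t \<in> X3 \<longleftrightarrow> t \<in> X3" "i\<Psi> t \<in> X3 \<longleftrightarrow> t \<in> X3"
  "leg12 F t \<in> X3 \<longleftrightarrow> t \<in> X3" "leg12 iF t \<in> X3 \<longleftrightarrow> t \<in> X3"
  "leg23 F t \<in> X3 \<longleftrightarrow> t \<in> X3" "leg23 iF t \<in> X3 \<longleftrightarrow> t \<in> X3"
  using F_permutes \<Phi>_permutes \<Psi>_permutes iF_permutes i\<Phi>_permutes i\<Psi>_permutes
  by (simp_all only: leg12_closed leg23_closed permutes_in_image)

lemma leg_r': "leg12 r' t = leg12 F (leg12 r (leg12 iF t))"
  "leg23 r' t = leg23 F (leg23 r (leg23 iF t))"
  by (simp_all add: leg12_comp leg23_comp)

lemma K_eq: "t \<in> X3 \<Longrightarrow> leg12 F (\<Psi> t) = leg23 F (\<Phi> t)"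
  using twist by simp

lemma \<Phi>_r: "t \<in> X3 \<Longrightarrow> \<Phi> (leg23 r t) = leg23 r (\<Phi> t)"
  and \<Psi>_r: "t \<in> X3 \<Longrightarrow> \<Psi> (leg12 r t) = leg12 r (\<Psi> t)"
  using twist by simp_all

lemma i\<Phi>_r: "t \<in> X3 \<Longrightarrow> i\<Phi> (leg23 r t) = leg23 r (i\<Phi> t)"
  and i\<Psi>_r: "t \<in> X3 \<Longrightarrow> i\<Psi> (leg12 r t) = leg12 r (i\<Psi> t)"
  using \<Phi>_r[of "i\<Phi> t"] \<Psi>_r[of "i\<Psi> t"] by (metis cancel closed)+

lemma K_inverse_eq: "t \<in> X3 \<Longrightarrow> i\<Psi> (leg12 iF t) = i\<Phi> (leg23 iF t)"
  using K_eq[of "i\<Phi> (leg23 iF t)"] by (metis cancel closed leg_cancel)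

lemma K_surj:
  assumes "t \<in> X3"
  obtains s where "s \<in> X3" "t = K s"
  using assms that[of "i\<Psi> (leg12 iF t)"] by simp

text \<open>
  The intertwiner \<open>K\<close> in its two forms: as \<open>F\<^sub>1\<^sub>2 \<Psi>\<close> it can be moved past \<open>r\<^sub>1\<^sub>2\<close>, as \<open>F\<^sub>2\<^sub>3 \<Phi>\<close> past \<open>r\<^sub>2\<^sub>3\<close>.
\<close>

lemma K_leg12: "s \<in> X3 \<Longrightarrow> leg12 r' (K s) = K (leg12 r s)"
  by (simp add: leg_r' \<Psi>_r)

lemma K_leg23: "s \<in> X3 \<Longrightarrow> leg23 r s \<in> X3 \<Longrightarrow> leg23 r' (K s) = K (leg23 r s)"
  by (simp add: leg_r' \<Phi>_r K_eq)

end

lemma YBE_solution_target: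
  assumes "YBE_solution S" "drinfeld_twist S t"
  shows "YBE_solution (ybe_target S t)"
proof -
  obtain X r F \<Phi> \<Psi> where St: "S = (X, r)" "t = (F, \<Phi>, \<Psi>)"
    by (metis surj_pair)
  interpret twist_on X r F \<Phi> \<Psi>
    using assms by unfold_locales (simp add: St)
  have r: "r permutes X \<times> X"
    and ybe: "\<And>t. t \<in> X3 \<Longrightarrow> leg23 r (leg12 r (leg23 r t)) = leg12 r (leg23 r (leg12 r t))"
    using assms(1) by (simp_all add: St)
  have "leg23 r' (leg12 r' (leg23 r' t)) = leg12 r' (leg23 r' (leg12 r' t))" if t: "t \<in> X3" for t
  proof -
    obtain s where "s \<in> X3" "t = K s"
      using t by (rule K_surj)
    then show ?thesis
      using ybe[of s] by (simp only: K_leg12 K_leg23 leg12_closed[OF r] leg23_closed[OF r])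
  qed
  moreover have "r' permutes X \<times> X"
    using iF_permutes r F_permutes by (intro permutes_compose)
  ultimately show ?thesis
    by (simp add: St)
qed

lemma drinfeld_twist_id: "drinfeld_twist S twist_id"
  by (cases S) (simp add: twist_id_def permutes_id)

text \<open>
  If \<open>\<phi>\<close> commutes with \<open>r'\<^sub>2\<^sub>3\<close>, then its conjugate by \<open>F\<^sub>2\<^sub>3\<close> commutes with \<open>r\<^sub>2\<^sub>3\<close>, and similarly for
  \<open>\<psi>\<close>. The intertwiner of the composite is the composite of the two intertwiners.
\<close>

lemma drinfeld_twist_comp:
  assumes "drinfeld_twist S t" "drinfeld_twist (ybe_target S t) u"
  shows "drinfeld_twist S (twist_comp u t)"
proof -
  obtain X r F \<Phi> \<Psi> F' \<phi> \<psi> where St: "S = (X, r)" "t = (F, \<Phi>, \<Psi>)" "u = (F', \<phi>, \<psi>)"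
    by (metis surj_pair)
  interpret twist_on X r F \<Phi> \<Psi>
    using assms by unfold_locales (simp add: St)
  interpret T': twist_on X r' F' \<phi> \<psi>
    using assms by unfold_locales (simp add: St)
  have "F' \<circ> F permutes X \<times> X"
    using F_permutes T'.F_permutes by (rule permutes_compose)
  moreover have "leg23 iF \<circ> \<phi> \<circ> leg23 F \<circ> \<Phi> permutes X3" "leg12 iF \<circ> \<psi> \<circ> leg12 F \<circ> \<Psi> permutes X3"
    using conjugate_permutes[OF T'.\<Phi>_permutes, of "leg23 F" "leg23 iF"]
      conjugate_permutes[OF T'.\<Psi>_permutes, of "leg12 F" "leg12 iF"]
    by (simp_all add: permutes_compose[OF \<Phi>_permutes] permutes_compose[OF \<Psi>_permutes])
  moreover have "(leg12 (F' \<circ> F) \<circ> (leg12 iF \<circ> \<psi> \<circ> leg12 F \<circ> \<Psi>)) t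
      = (leg23 (F' \<circ> F) \<circ> (leg23 iF \<circ> \<phi> \<circ> leg23 F \<circ> \<Phi>)) t" if "t \<in> X3" for t
    using that by (simp add: leg12_comp leg23_comp T'.K_eq K_eq)
  moreover have "(leg23 iF \<circ> \<phi> \<circ> leg23 F \<circ> \<Phi>) (leg23 r t) = leg23 r ((leg23 iF \<circ> \<phi> \<circ> leg23 F \<circ> \<Phi>) t)"
    if "t \<in> X3" for t
    using that T'.\<Phi>_r[of "leg23 F (\<Phi> t)"] by (simp add: \<Phi>_r leg_r')
  moreover have "(leg12 iF \<circ> \<psi> \<circ> leg12 F \<circ> \<Psi>) (leg12 r t) = leg12 r ((leg12 iF \<circ> \<psi> \<circ> leg12 F \<circ> \<Psi>) t)"
    if "t \<in> X3" for t
    using that T'.\<Psi>_r[of "leg12 F (\<Psi> t)"] by (simp add: \<Psi>_r leg_r')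
  ultimately show ?thesis
    by (simp add: St)
qed

text \<open>
  The intertwiner of the inverse twist is \<open>K\<inverse>\<close>: in \<open>F\<^sub>1\<^sub>2\<inverse> F\<^sub>1\<^sub>2 \<Psi>\<inverse> F\<^sub>1\<^sub>2\<inverse>\<close> the first two factors cancel.
\<close>

lemma drinfeld_twist_inv:
  assumes "drinfeld_twist S t"
  shows "drinfeld_twist (ybe_target S t) (twist_inv t)"
proof -
  obtain X r F \<Phi> \<Psi> where St: "S = (X, r)" "t = (F, \<Phi>, \<Psi>)"
    by (metis surj_pair)
  interpret twist_on X r F \<Phi> \<Psi>
    using assms by unfold_locales (simp add: St)
  have "leg23 F \<circ> i\<Phi> \<circ> leg23 iF permutes X3" "leg12 F \<circ> i\<Psi> \<circ> leg12 iF permutes X3"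
    using conjugate_permutes[OF i\<Phi>_permutes, of "leg23 iF" "leg23 F"]
      conjugate_permutes[OF i\<Psi>_permutes, of "leg12 iF" "leg12 F"]
    by simp_all
  then show ?thesis
    using iF_permutes by (simp add: St K_inverse_eq i\<Phi>_r i\<Psi>_r leg_r')
qed

lemma ybe_target_id: "ybe_target S twist_id = S"
  by (cases S) (simp add: twist_id_def)

lemma ybe_target_comp:
  assumes "drinfeld_twist S t" "drinfeld_twist (ybe_target S t) u"
  shows "ybe_target S (twist_comp u t) = ybe_target (ybe_target S t) u"
proof -
  obtain X r F \<Phi> \<Psi> F' \<phi> \<psi> where St: "S = (X, r)" "t = (F, \<Phi>, \<Psi>)" "u = (F', \<phi>, \<psi>)"
    by (metis surj_pair)
  have "bij F" "bij F'"
    using assms by (auto simp: St intro: permutes_bij)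
  then show ?thesis
    by (simp add: St o_inv_distrib o_assoc)
qed

lemma ybe_target_inv:
  assumes "drinfeld_twist S t"
  shows "ybe_target (ybe_target S t) (twist_inv t) = S"
proof -
  obtain X r F \<Phi> \<Psi> where St: "S = (X, r)" "t = (F, \<Phi>, \<Psi>)"
    by (metis surj_pair)
  interpret twist_on X r F \<Phi> \<Psi>
    using assms by unfold_locales (simp add: St)
  show ?thesis
    by (simp add: St fun_eq_iff)
qed

lemma twist_comp_id: "twist_comp t twist_id = t" "twist_comp twist_id t = t" if "drinfeld_twist S t"
proof -
  obtain X r F \<Phi> \<Psi> where St: "S = (X, r)" "t = (F, \<Phi>, \<Psi>)"
    by (metis surj_pair)
  interpret twist_on X r F \<Phi> \<Psi>
    using that by unfold_locales (simp add: St)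
  show "twist_comp t twist_id = t" "twist_comp twist_id t = t"
    by (simp_all add: St twist_id_def)
qed

lemma twist_comp_inv:
  assumes "drinfeld_twist S t"
  shows "twist_comp (twist_inv t) t = twist_id" "twist_comp t (twist_inv t) = twist_id"
proof -
  obtain X r F \<Phi> \<Psi> where St: "S = (X, r)" "t = (F, \<Phi>, \<Psi>)"
    by (metis surj_pair)
  interpret twist_on X r F \<Phi> \<Psi>
    using assms by unfold_locales (simp add: St)
  have "inverse_map (leg12 iF) = leg12 F" "inverse_map (leg23 iF) = leg23 F"
    using permutes_bij[OF iF_permutes] by (simp_all add: leg12_inverse_map leg23_inverse_map)
  then show "twist_comp (twist_inv t) t = twist_id" "twist_comp t (twist_inv t) = twist_id"
    by (simp_all add: St twist_id_def fun_eq_iff del: split_paired_All)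
qed

lemma twist_comp_assoc:
  assumes "drinfeld_twist S t" "drinfeld_twist S' u"
  shows "twist_comp v (twist_comp u t) = twist_comp (twist_comp v u) t"
proof -
  obtain X r F \<Phi> \<Psi> X' s F' \<phi> \<psi> F'' \<phi>' \<psi>'
    where St: "S = (X, r)" "t = (F, \<Phi>, \<Psi>)" "S' = (X', s)" "u = (F', \<phi>, \<psi>)" "v = (F'', \<phi>', \<psi>')"
    by (metis surj_pair)
  interpret twist_on X r F \<Phi> \<Psi>
    using assms by unfold_locales (simp add: St)
  interpret T': twist_on X' s F' \<phi> \<psi>
    using assms by unfold_locales (simp add: St)
  have "inverse_map (leg12 (F' \<circ> F)) = leg12 iF \<circ> leg12 T'.iF"
    "inverse_map (leg23 (F' \<circ> F)) = leg23 iF \<circ> leg23 T'.iF"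
    using bij_F T'.bij_F
    by (simp_all add: leg12_inverse_map leg23_inverse_map bij_comp o_inv_distrib
      flip: leg12_comp leg23_comp)
  then show ?thesis
    by (simp add: St fun_eq_iff leg12_comp leg23_comp del: split_paired_All)
qed

lemma YBE_groupoid: "groupoid YBE_groupoid"
  by unfold_locales
    (auto simp: YBE_groupoid_def YBE_solution_target drinfeld_twist_id drinfeld_twist_comp
      drinfeld_twist_inv ybe_target_id ybe_target_comp ybe_target_inv twist_comp_id twist_comp_inv
      simp del: drinfeld_twist.simps YBE_solution.simps ybe_target.simps twist_comp.simps
        twist_inv.simps split_paired_All
      intro: twist_comp_assoc)

section \<open>Groups with braiding operators\<close>

locale braided_group =
  fixes G :: "'a set" and m :: "'a \<times> 'a \<Rightarrow> 'a" and e :: 'a and r :: "'a map2"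
  assumes brace: "skew_brace (G, m, e, r)"
begin

abbreviation grp :: "'a monoid" where
  "grp \<equiv> \<lparr>carrier = G, monoid.mult = curry m, one = e\<rparr>"

abbreviation mul (infixl "\<cdot>" 70) where "x \<cdot> y \<equiv> m (x, y)"
abbreviation lact (infixr "\<rhd>" 75) where "x \<rhd> y \<equiv> fst (r (x, y))"
abbreviation ract (infixl "\<lhd>" 75) where "x \<lhd> y \<equiv> snd (r (x, y))"
abbreviation iv where "iv x \<equiv> m_inv grp x"

sublocale grp: group grp
  rewrites "carrier grp = G" and "monoid.mult grp = curry m" and "one grp = e"
  using brace by auto

lemmas group_facts [simp] =
  grp.m_closed[simplified] grp.one_closed grp.l_one[simplified] grp.r_one[simplified]
  grp.l_inv[simplified] grp.r_inv[simplified] grp.inv_closed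

lemma m_extensional: "m \<in> extensional (G \<times> G)"
  using brace by simp

lemma braiding: "braiding_operator (G, m, e, r)"
  using brace by simp

lemma r_closed: "r \<in> G \<times> G \<rightarrow> G \<times> G" and r_outside: "p \<notin> G \<times> G \<Longrightarrow> r p = p"
  using braiding by (simp_all del: split_paired_All)

lemma r_unit [simp]: "g \<in> G \<Longrightarrow> r (e, g) = (g, e)" "g \<in> G \<Longrightarrow> r (g, e) = (e, g)"
  using braiding by auto

lemma act_closed [simp]: "x \<in> G \<Longrightarrow> y \<in> G \<Longrightarrow> x \<rhd> y \<in> G" "x \<in> G \<Longrightarrow> y \<in> G \<Longrightarrow> x \<lhd> y \<in> G"
  using r_closed by (auto simp: Pi_iff mem_Times_iff)

lemma r_mult12: "t \<in> G \<times> G \<times> G \<Longrightarrow> r (mult12 m t) = mult23 m (leg12 r (leg23 r t))"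
  and r_mult23: "t \<in> G \<times> G \<times> G \<Longrightarrow> r (mult23 m t) = mult12 m (leg23 r (leg12 r t))"
  using braiding by simp_all

lemma m_r: "p \<in> G \<times> G \<Longrightarrow> m (r p) = m p"
  using braiding by simp

text \<open>
  The components of the two hexagon identities: \<open>\<rhd>\<close> is a left and \<open>\<lhd>\<close> a right action of \<open>G\<close> on the
  set \<open>G\<close>, and \<open>\<lhd>\<close> is multiplicative in its left argument up to a twist by \<open>\<rhd>\<close>.
\<close>

lemma act_mul:
  assumes "x \<in> G" "y \<in> G" "z \<in> G"
  shows lact_mul: "(x \<cdot> y) \<rhd> z = x \<rhd> y \<rhd> z"
    and mul_ract: "(x \<cdot> y) \<lhd> z = (x \<lhd> (y \<rhd> z)) \<cdot> (y \<lhd> z)"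
    and ract_mul: "x \<lhd> (y \<cdot> z) = x \<lhd> y \<lhd> z"
  using r_mult12[of "(x, y, z)"] r_mult23[of "(x, y, z)"] assms
  by (simp_all add: apply_pairwise)

lemma lact_mul_ract: "x \<in> G \<Longrightarrow> y \<in> G \<Longrightarrow> (x \<rhd> y) \<cdot> (x \<lhd> y) = x \<cdot> y"
  using m_r[of "(x, y)"] by simp

lemma lact_inv: "x \<in> G \<Longrightarrow> y \<in> G \<Longrightarrow> iv x \<rhd> x \<rhd> y = y" "x \<in> G \<Longrightarrow> y \<in> G \<Longrightarrow> x \<rhd> iv x \<rhd> y = y"
  by (simp_all flip: lact_mul)

lemma ract_inv: "x \<in> G \<Longrightarrow> y \<in> G \<Longrightarrow> x \<lhd> y \<lhd> iv y = x" "x \<in> G \<Longrightarrow> y \<in> G \<Longrightarrow> x \<lhd> iv y \<lhd> y = x"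
  by (simp_all flip: ract_mul)

text \<open>
  Since \<open>e \<lhd> y = e\<close>, expanding \<open>(x\<inverse> x) \<lhd> y\<close> gives \<open>(x\<inverse> \<lhd> (x \<rhd> y)) (x \<lhd> y) = e\<close>. This is what recovers
  \<open>(x, y)\<close> from its image under \<open>r\<close>.
\<close>

lemma inv_ract:
  assumes "x \<in> G" "y \<in> G"
  shows "iv x \<lhd> (x \<rhd> y) = iv (x \<lhd> y)"
proof -
  have "(iv x \<lhd> (x \<rhd> y)) \<cdot> (x \<lhd> y) = e"
    using mul_ract[of "iv x" x y] assms by simp
  then show ?thesis
    using assms by (intro grp.inv_equality[symmetric]) simp_all
qed

text \<open>
  If \<open>r (x, y) = (u, v)\<close>, then \<open>x\<inverse> \<lhd> u = v\<inverse>\<close> by the previous lemma, so \<open>a = x\<inverse>\<close> is \<open>v\<inverse> \<lhd> u\<inverse>\<close>, and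
  \<open>y = x\<inverse> \<rhd> u\<close>.
\<close>

definition r_inv :: "'a \<times> 'a \<Rightarrow> 'a \<times> 'a" where
  "r_inv = (\<lambda>(u, v). let a = iv v \<lhd> iv u in (iv a, a \<rhd> u))"

lemma r_inv_left:
  assumes "x \<in> G" "y \<in> G"
  shows "r_inv (r (x, y)) = (x, y)"
proof -
  have "iv (x \<lhd> y) \<lhd> iv (x \<rhd> y) = iv x"
    using assms by (simp add: ract_inv flip: inv_ract)
  then show ?thesis
    using assms by (simp add: r_inv_def case_prod_beta lact_inv)
qed

lemma r_inv_right:
  assumes "u \<in> G" "v \<in> G"
  shows "r (r_inv (u, v)) = (u, v)"
proof -
  define a where "a = iv v \<lhd> iv u"
  have a: "a \<in> G" "a \<lhd> u = iv v"
    using assms by (simp_all add: a_def ract_inv)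
  have "iv (iv a \<lhd> (a \<rhd> u)) = iv v"
    using inv_ract[of "iv a" "a \<rhd> u"] a assms by (simp add: lact_inv)
  then have "iv a \<lhd> (a \<rhd> u) = v"
    using a assms by (metis act_closed grp.inv_inv group_facts(7))
  then show ?thesis
    using a assms by (simp add: r_inv_def lact_inv prod_eq_iff flip: a_def)
qed

lemma r_permutes: "r permutes G \<times> G"
proof (rule bij_imp_permutes)
  show "bij_betw r (G \<times> G) (G \<times> G)"
  proof (rule bij_betw_byWitness[where f' = r_inv])
    show "r ` (G \<times> G) \<subseteq> G \<times> G"
      using r_closed by (rule funcset_image)
    show "r_inv ` (G \<times> G) \<subseteq> G \<times> G"
      by (simp add: image_subset_iff r_inv_def Let_def case_prod_beta mem_Times_iff)
  qed (auto simp: r_inv_left r_inv_right)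
qed (rule r_outside)

lemmas leg_closed = leg12_closed[OF r_permutes] leg23_closed[OF r_permutes]

text \<open>
  On both sides the first component is \<open>(x y) \<rhd> z\<close> and the last is \<open>x \<lhd> (y z)\<close>. Both sides multiply
  to \<open>x y z\<close>, because \<open>m r = m\<close>, so the middle components agree by cancellation in \<open>G\<close>.
\<close>

lemma yang_baxter:
  assumes "t \<in> G \<times> G \<times> G"
  shows "leg23 r (leg12 r (leg23 r t)) = leg12 r (leg23 r (leg12 r t))"
proof -
  obtain x y z where t: "t = (x, y, z)" "x \<in> G" "y \<in> G" "z \<in> G"
    using assms by auto
  obtain u v w where l: "leg23 r (leg12 r (leg23 r t)) = (u, v, w)"
    by (metis surj_pair)
  obtain u' v' w' where r: "leg12 r (leg23 r (leg12 r t)) = (u', v', w')"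
    by (metis surj_pair)
  have G: "u \<in> G" "v \<in> G" "w \<in> G" "u' \<in> G" "v' \<in> G" "w' \<in> G"
    using leg_closed assms l r by (metis mem_Times_iff fst_conv snd_conv)+
  have prod12: "m (mult23 m (leg12 r s)) = m (mult23 m s)"
    and prod23: "m (mult23 m (leg23 r s)) = m (mult23 m s)" if "s \<in> G \<times> G \<times> G" for s
    using that
    by (cases s; simp add: apply_pairwise m_r lact_mul_ract flip: grp.m_assoc[simplified])+
  have "u = u'"
    using l r t lact_mul[of x y z] lact_mul[of "x \<rhd> y" "x \<lhd> y" z] lact_mul_ract[of x y]
    by (simp add: apply_pairwise)
  moreover have "w = w'"
    using l r t ract_mul[of x y z] ract_mul[of x "y \<rhd> z" "y \<lhd> z"] lact_mul_ract[of y z]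
    by (simp add: apply_pairwise)
  moreover have "u \<cdot> (v \<cdot> w) = u' \<cdot> (v' \<cdot> w')"
    using prod12 prod23 leg_closed assms l r by (metis mult23.simps)
  ultimately show ?thesis
    using G l r by (simp add: grp.Units_l_cancel[simplified] grp.right_cancel[simplified])
qed

lemma YBE: "YBE_solution (G, r)"
  using r_permutes yang_baxter by simp

end

lemma YBE_solution_underlying: "skew_brace B \<Longrightarrow> YBE_solution (underlying_ybe B)"
  by (cases B) (metis braided_group.YBE braided_group.intro underlying_ybe.simps)

section \<open>Drinfeld twists on groups with braiding operators\<close>

lemma mult12_comp: "mult12 (m \<circ> f) t = mult12 m (leg12 f t)"
  by (cases t) (simp split: prod.splits)

lemma mult23_comp: "mult23 (m \<circ> f) t = mult23 m (leg23 f t)"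
  by (cases t) (metis comp_apply leg23_apply mult23.simps surj_pair)

lemma drinfeld_twist_underlying: "brace_twist B t \<Longrightarrow> drinfeld_twist (underlying_ybe B) t"
  by (cases B; cases t) simp

lemma underlying_target: "underlying_ybe (brace_target B t) = ybe_target (underlying_ybe B) t"
  by (cases B; cases t) simp

text \<open>
  (G3) and (G4) as identities of maps on \<open>G\<^sup>3\<close>, the form in which they compose with (T1)-(T3).
\<close>

lemma brace_twist_iff:
  "brace_twist (G, m, e, r) (F, \<Phi>, \<Psi>) \<longleftrightarrow>
    drinfeld_twist (G, r) (F, \<Phi>, \<Psi>) \<and>
    (\<forall>x \<in> G. \<forall>y \<in> G. \<Psi> (x, y, e) = (x, y, e) \<and> \<Phi> (e, x, y) = (e, x, y)) \<and>
    (\<forall>x \<in> G. F (e, x) = (e, x) \<and> F (x, e) = (x, e)) \<and>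
    (\<forall>t \<in> G \<times> G \<times> G. mult23 m (\<Phi> t) = F (mult23 m t) \<and> mult12 m (\<Psi> t) = F (mult12 m t))"
  by (simp only: brace_twist.simps split_paired_Ball_Sigma mult12.simps mult23.simps)

locale brace_twist_on = braided_group G m e r
  for G :: "'a set" and m :: "'a \<times> 'a \<Rightarrow> 'a" and e :: 'a and r :: "'a map2" +
  fixes F :: "'a map2" and \<Phi> \<Psi> :: "'a map3"
  assumes brace_twist: "brace_twist (G, m, e, r) (F, \<Phi>, \<Psi>)"
begin

sublocale twist_on G r F \<Phi> \<Psi>
  using brace_twist by unfold_locales simp

abbreviation "m' \<equiv> m \<circ> iF"

lemma unit_fixed [simp]:
  "x \<in> G \<Longrightarrow> y \<in> G \<Longrightarrow> \<Psi> (x, y, e) = (x, y, e)" "x \<in> G \<Longrightarrow> y \<in> G \<Longrightarrow> \<Phi> (e, x, y) = (e, x, y)"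
  "x \<in> G \<Longrightarrow> F (e, x) = (e, x)" "x \<in> G \<Longrightarrow> F (x, e) = (x, e)"
  using brace_twist by simp_all

lemma unit_fixed_inverse [simp]:
  "x \<in> G \<Longrightarrow> y \<in> G \<Longrightarrow> i\<Psi> (x, y, e) = (x, y, e)" "x \<in> G \<Longrightarrow> y \<in> G \<Longrightarrow> i\<Phi> (e, x, y) = (e, x, y)"
  "x \<in> G \<Longrightarrow> iF (e, x) = (e, x)" "x \<in> G \<Longrightarrow> iF (x, e) = (x, e)"
  using unit_fixed cancel by metis+

lemma mult_\<Phi>: "t \<in> X3 \<Longrightarrow> mult23 m (\<Phi> t) = F (mult23 m t)"
  and mult_\<Psi>: "t \<in> X3 \<Longrightarrow> mult12 m (\<Psi> t) = F (mult12 m t)"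
  using brace_twist unfolding brace_twist_iff by blast+

lemma mult_i\<Phi>: "t \<in> X3 \<Longrightarrow> mult23 m (i\<Phi> t) = iF (mult23 m t)"
  and mult_i\<Psi>: "t \<in> X3 \<Longrightarrow> mult12 m (i\<Psi> t) = iF (mult12 m t)"
  using mult_\<Phi>[of "i\<Phi> t"] mult_\<Psi>[of "i\<Psi> t"] by (metis cancel closed)+

text \<open>
  The analogue of the intertwining property for the multiplications: since \<open>m' F = m\<close>, the factor
  \<open>F\<^sub>1\<^sub>2\<close> or \<open>F\<^sub>2\<^sub>3\<close> of \<open>K\<close> is absorbed, and (G4) or (G3) applies to the other one.
\<close>

lemma K_mult12: "s \<in> X3 \<Longrightarrow> mult12 m' (K s) = F (mult12 m s)"
  by (simp add: mult12_comp mult_\<Psi>)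

lemma K_mult23: "s \<in> X3 \<Longrightarrow> mult23 m' (K s) = F (mult23 m s)"
  by (simp add: mult23_comp mult_\<Phi> K_eq)

lemma target_assoc:
  assumes "t \<in> X3"
  shows "m' (mult12 m' t) = m' (mult23 m' t)"
proof -
  obtain s where s: "s \<in> X3" "t = K s"
    using assms by (rule K_surj)
  have "m (mult12 m s) = m (mult23 m s)"
    using s(1) grp.m_assoc by auto
  then show ?thesis
    using s by (simp only: K_mult12 K_mult23 comp_apply[of m] cancel)
qed

text \<open>
  By (G4), \<open>\<Psi> (a, a\<inverse>, a) = (b, b', a)\<close> with \<open>b b' = e\<close>, because \<open>F (e, a) = (e, a)\<close>; by (G3),
  \<open>\<Phi> (a, a\<inverse>, a) = (a, c, c')\<close> with \<open>c c' = e\<close>. Now (T1) reads \<open>(F (b, b'), a) = (a, F (c, c'))\<close>, which forces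
  \<open>F (b, b') = (a, q)\<close> and \<open>F (c, c') = (q, a)\<close> for one \<open>q\<close>. As \<open>m' F = m\<close>, this \<open>q\<close> is a two-sided inverse
  of \<open>a\<close> for \<open>m'\<close>.
\<close>

lemma target_inverse:
  assumes a: "a \<in> G"
  obtains y where "y \<in> G" "m' (a, y) = e" "m' (y, a) = e"
proof -
  let ?s = "(a, iv a, a)"
  have s: "?s \<in> X3"
    using a by simp
  obtain b b' z where \<Psi>s: "\<Psi> ?s = (b, b', z)"
    by (metis surj_pair)
  obtain x c c' where \<Phi>s: "\<Phi> ?s = (x, c, c')"
    by (metis surj_pair)
  have b: "m (b, b') = e" "z = a"
    using mult_\<Psi>[OF s] \<Psi>s a by simp_all
  have c: "m (c, c') = e" "x = a"
    using mult_\<Phi>[OF s] \<Phi>s a by simp_all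
  obtain p q where F: "F (b, b') = (p, q)"
    by (metis surj_pair)
  have "(p, q, a) = (a, F (c, c'))"
    using K_eq[OF s] b c F by (simp add: \<Psi>s \<Phi>s)
  then have "F (b, b') = (a, q)" "F (c, c') = (q, a)"
    using F by simp_all
  then have iF: "iF (a, q) = (b, b')" "iF (q, a) = (c, c')"
    using cancel(2) by metis+
  have "(b, b') \<in> G \<times> G"
    using s \<Psi>s by (metis closed(4) mem_Sigma_iff)
  then have "(a, q) \<in> G \<times> G"
    using closed(2)[of "(a, q)"] iF by simp
  then show ?thesis
    using that[of q] iF b c by simp
qed

text \<open>
  Every triple of \<open>G\<^sup>3\<close> is \<open>K s\<close> for some \<open>s\<close>, and at \<open>K s\<close> both sides of the two identities that relate
  \<open>r'\<close> to \<open>m'\<^sub>1\<^sub>2\<close> and \<open>m'\<^sub>2\<^sub>3\<close> are the images under \<open>F\<close> of those for \<open>(m, r)\<close> at \<open>s\<close>.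
\<close>

lemma skew_brace_target: "skew_brace (G, m', e, r')"
proof -
  have m': "m' (x, y) \<in> G" if "x \<in> G" "y \<in> G" for x y
    using that closed(2)[of "(x, y)"] by (cases "iF (x, y)") simp
  have "group \<lparr>carrier = G, monoid.mult = curry m', one = e\<rparr>"
  proof (rule groupI; simp only: partial_object.simps monoid.simps curry_def)
    fix x y z assume "x \<in> G" "y \<in> G" "z \<in> G"
    then show "m' (m' (x, y), z) = m' (x, m' (y, z))"
      using target_assoc[of "(x, y, z)"] by simp
  next
    fix x assume "x \<in> G"
    then show "\<exists>y\<in>G. m' (y, x) = e"
      using target_inverse by metis
  qed (use m' in simp_all)
  moreover have "m' \<in> extensional (G \<times> G)"
    using m_extensional by (auto simp: extensional_def permutes_not_in[OF iF_permutes])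
  moreover have "braiding_operator (G, m', e, r')"
  proof -
    have perm: "r' permutes G \<times> G"
      using iF_permutes r_permutes F_permutes by (intro permutes_compose)
    have "r' (mult12 m' t) = mult23 m' (leg12 r' (leg23 r' t)) \<and>
        r' (mult23 m' t) = mult12 m' (leg23 r' (leg12 r' t))" if t: "t \<in> X3" for t
    proof -
      obtain s where s: "s \<in> X3" "t = K s"
        using t by (rule K_surj)
      then show ?thesis
        by (simp only: leg_closed K_leg12 K_leg23 K_mult12 K_mult23 comp_apply[of F] comp_apply[of _ iF]
          comp_apply[of r] cancel r_mult12 r_mult23)
    qed
    moreover have "m' (r' p) = m' p" if "p \<in> G \<times> G" for p
      using that by (simp add: m_r)
    moreover have "r' (e, g) = (g, e) \<and> r' (g, e) = (e, g)" if "g \<in> G" for g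
      using that by simp
    moreover have "r' \<in> G \<times> G \<rightarrow> G \<times> G"
      using permutes_in_image[OF perm] by blast
    moreover have "\<forall>p. p \<notin> G \<times> G \<longrightarrow> r' p = p"
      using permutes_not_in[OF perm] by blast
    ultimately show ?thesis
      by (simp del: split_paired_All)
  qed
  ultimately show ?thesis
    by simp
qed

end

lemma skew_brace_target:
  assumes "skew_brace B" "brace_twist B t"
  shows "skew_brace (brace_target B t)"
proof -
  obtain G m e r F \<Phi> \<Psi> where Bt: "B = (G, m, e, r)" "t = (F, \<Phi>, \<Psi>)"
    by (metis surj_pair)
  interpret brace_twist_on G m e r F \<Phi> \<Psi>
    using assms by unfold_locales (simp_all only: Bt)
  show ?thesis
    using skew_brace_target by (simp only: Bt brace_target.simps)
qed

lemma brace_twist_id: "brace_twist B twist_id"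
  using drinfeld_twist_id[of "underlying_ybe B"]
  by (cases B) (simp add: twist_id_def brace_twist_iff del: drinfeld_twist.simps brace_twist.simps)

text \<open>
  The conjugated \<open>\<phi>\<close> satisfies (G3) up to \<open>F\<close>: \<open>m\<^sub>2\<^sub>3 F\<^sub>2\<^sub>3\<inverse> = m'\<^sub>2\<^sub>3\<close>, so
  \<open>m\<^sub>2\<^sub>3 F\<^sub>2\<^sub>3\<inverse> \<phi> F\<^sub>2\<^sub>3 \<Phi> = F' m'\<^sub>2\<^sub>3 F\<^sub>2\<^sub>3 \<Phi> = F' m\<^sub>2\<^sub>3 \<Phi> = F' F m\<^sub>2\<^sub>3\<close>. For (G1), \<open>F\<^sub>2\<^sub>3\<close> maps the set of triples with
  first entry \<open>e\<close> to itself, and \<open>\<phi>\<close> fixes them; in the same way for \<open>\<psi>\<close>.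
\<close>

lemma brace_twist_comp:
  assumes B: "skew_brace B" and t: "brace_twist B t" and u: "brace_twist (brace_target B t) u"
  shows "brace_twist B (twist_comp u t)"
proof -
  obtain G m e r F \<Phi> \<Psi> F' \<phi> \<psi>
    where Bt: "B = (G, m, e, r)" "t = (F, \<Phi>, \<Psi>)" "u = (F', \<phi>, \<psi>)"
    by (metis surj_pair)
  interpret brace_twist_on G m e r F \<Phi> \<Psi>
    using B t by unfold_locales (simp_all only: Bt)
  interpret T': brace_twist_on G m' e r' F' \<phi> \<psi>
    using skew_brace_target u by unfold_locales (simp_all only: Bt brace_target.simps)
  have "drinfeld_twist (G, r) (twist_comp u t)"
    using drinfeld_twist_comp[of "(G, r)" t u] drinfeld_twist_underlying[OF t]
      drinfeld_twist_underlying[OF u] by (simp add: Bt del: drinfeld_twist.simps)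
  moreover have "mult23 m (leg23 iF (\<phi> (leg23 F (\<Phi> t)))) = F' (F (mult23 m t))" if "t \<in> X3" for t
    using that T'.mult_\<Phi>[of "leg23 F (\<Phi> t)"] by (simp add: mult23_comp mult_\<Phi>)
  moreover have "mult12 m (leg12 iF (\<psi> (leg12 F (\<Psi> t)))) = F' (F (mult12 m t))" if "t \<in> X3" for t
    using that T'.mult_\<Psi>[of "leg12 F (\<Psi> t)"] by (simp add: mult12_comp mult_\<Psi>)
  moreover have "leg23 iF (\<phi> (leg23 F (\<Phi> (e, x, y)))) = (e, x, y)" if "x \<in> G" "y \<in> G" for x y
    using that closed(1)[of "(x, y)"] leg_cancel(4)[of "(e, x, y)"] by (cases "F (x, y)") simp
  moreover have "leg12 iF (\<psi> (leg12 F (\<Psi> (x, y, e)))) = (x, y, e)" if "x \<in> G" "y \<in> G" for x y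
    using that closed(1)[of "(x, y)"] leg_cancel(2)[of "(x, y, e)"] by (cases "F (x, y)") simp
  ultimately show ?thesis
    by (simp add: Bt brace_twist_iff del: drinfeld_twist.simps brace_twist.simps)
qed

lemma brace_twist_inv:
  assumes B: "skew_brace B" and t: "brace_twist B t"
  shows "brace_twist (brace_target B t) (twist_inv t)"
proof -
  obtain G m e r F \<Phi> \<Psi> where Bt: "B = (G, m, e, r)" "t = (F, \<Phi>, \<Psi>)"
    by (metis surj_pair)
  interpret brace_twist_on G m e r F \<Phi> \<Psi>
    using B t by unfold_locales (simp_all only: Bt)
  have "drinfeld_twist (G, r') (twist_inv t)"
    using drinfeld_twist_inv[OF drinfeld_twist_underlying[OF t]]
    by (simp add: Bt del: drinfeld_twist.simps)
  moreover have "leg23 F (i\<Phi> (leg23 iF (e, x, y))) = (e, x, y)" if "x \<in> G" "y \<in> G" for x y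
    using that closed(2)[of "(x, y)"] leg_cancel(3)[of "(e, x, y)"] by (cases "iF (x, y)") simp
  moreover have "leg12 F (i\<Psi> (leg12 iF (x, y, e))) = (x, y, e)" if "x \<in> G" "y \<in> G" for x y
    using that closed(2)[of "(x, y)"] leg_cancel(1)[of "(x, y, e)"] by (cases "iF (x, y)") simp
  ultimately show ?thesis
    by (simp add: Bt brace_twist_iff mult12_comp mult23_comp mult_i\<Phi> mult_i\<Psi>
        del: drinfeld_twist.simps brace_twist.simps)
qed

lemma brace_target_id: "brace_target B twist_id = B"
  by (cases B) (simp add: twist_id_def)

lemma brace_target_comp:
  assumes "brace_twist B t" "brace_twist (brace_target B t) u"
  shows "brace_target B (twist_comp u t) = brace_target (brace_target B t) u"
proof -
  obtain G m e r F \<Phi> \<Psi> F' \<phi> \<psi>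
    where Bt: "B = (G, m, e, r)" "t = (F, \<Phi>, \<Psi>)" "u = (F', \<phi>, \<psi>)"
    by (metis surj_pair)
  have "bij F" "bij F'"
    using assms by (auto simp: Bt intro: permutes_bij)
  then show ?thesis
    by (simp add: Bt o_inv_distrib o_assoc)
qed

lemma brace_target_inv:
  assumes "brace_twist B t"
  shows "brace_target (brace_target B t) (twist_inv t) = B"
proof -
  obtain G m e r F \<Phi> \<Psi> where Bt: "B = (G, m, e, r)" "t = (F, \<Phi>, \<Psi>)"
    by (metis surj_pair)
  interpret twist_on G r F \<Phi> \<Psi>
    using assms by unfold_locales (simp add: Bt)
  show ?thesis
    by (simp add: Bt fun_eq_iff)
qed

lemma skew_brace_groupoid: "groupoid skew_brace_groupoid"
  by unfold_locales
    (auto simp: skew_brace_groupoid_def skew_brace_target brace_twist_id brace_twist_comp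
      brace_twist_inv brace_target_id brace_target_comp brace_target_inv
      simp del: brace_twist.simps skew_brace.simps brace_target.simps twist_comp.simps
        twist_inv.simps split_paired_All
      intro: twist_comp_assoc twist_comp_id twist_comp_inv drinfeld_twist_underlying)

theorem theorem2p6:
  "subgroupoid_along
     (skew_brace_groupoid :: ('a brace_obj, 'a brace_obj \<times> 'a twist) groupoid_data)
     (YBE_groupoid :: ('a ybe_obj, 'a ybe_obj \<times> 'a twist) groupoid_data)
     underlying_ybe underlying_arr"
proof -
  interpret C: groupoid "skew_brace_groupoid :: ('a brace_obj, 'a brace_obj \<times> 'a twist) groupoid_data"
    by (rule skew_brace_groupoid)
  interpret D: groupoid "YBE_groupoid :: ('a ybe_obj, 'a ybe_obj \<times> 'a twist) groupoid_data"
    by (rule YBE_groupoid)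
  show ?thesis
    by unfold_locales
      (auto simp: skew_brace_groupoid_def YBE_groupoid_def underlying_arr_def underlying_target
        dest: YBE_solution_underlying drinfeld_twist_underlying
        simp del: brace_twist.simps skew_brace.simps brace_target.simps twist_comp.simps
          twist_inv.simps split_paired_All drinfeld_twist.simps YBE_solution.simps ybe_target.simps)
qed

end
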